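(* Let $g\in\mathcal{C}(\overline{\mathbb{D}})$ and $f,h\in\mathcal{C}(\mathbb{T})$ be such that $\|f\|_\infty\leq 1$ and $\|f+h\|_\infty\leq 1$, and suppose that $\Phi\in\mathcal{C}^4(\mathbb{D})\cap\mathcal{C}(\overline{\mathbb{D}})$ satisfies $$\Delta^2\Phi=g\ \text{ in }\mathbb{D},\qquad \Phi=f\ \text{ on }\mathbb{T},\qquad \partial_n\Phi=h\ \text{ on }\mathbb{T}.$$ If $\lim_{r\to1}|\Phi(r\eta)|=1$ for $\eta\in\mathbb{T}$, then $$\liminf_{r\to 1}\frac{|\Phi(\eta)-\Phi(r\eta)|}{1-r}\geq 1-\|f+h\|_\infty.$$ In particular, if $\|f+h\|_\infty=0$, then $$\liminf_{r\to 1}\frac{|\Phi(\eta)-\Phi(r\eta)|}{1-r}\geq 1,$$ and this last estimate is sharp (the constant $1$ cannot be replaced by a larger one).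
   Context: $\mathbb{D}=\{z\in\mathbb{C}:|z|<1\}$, $\mathbb{T}=\partial\mathbb{D}$, $\overline{\mathbb{D}}=\mathbb{D}\cup\mathbb{T}$; all functions are complex-valued. $\Delta=\partial_x^2+\partial_y^2$ is the Laplacian and $\Delta^2\Phi=\Delta(\Delta\Phi)$. $\partial_n$ denotes differentiation in the inward normal direction on $\mathbb{T}$. $\|f\|_\infty=\sup_{\zeta\in\mathbb{T}}|f(\zeta)|$, $\|f+h\|_\infty=\sup_{\zeta\in\mathbb{T}}|f(\zeta)+h(\zeta)|$. Limits as $r\to1$ are over $r\in(0,1)$. The point $\eta$ is a given point of $\mathbb{T}$. *)

theory Defs
  imports "HOL-Analysis.Analysis"
begin

text \<open>Partial derivatives of complex-valued functions on the plane, with \<open>z = x + i y\<close>. On an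
  open set they only depend on the values of the function on that set.\<close>

definition partial_x :: "(complex \<Rightarrow> complex) \<Rightarrow> complex \<Rightarrow> complex" where
  "partial_x F z = vector_derivative (\<lambda>t::real. F (z + of_real t)) (at 0)"

definition partial_y :: "(complex \<Rightarrow> complex) \<Rightarrow> complex \<Rightarrow> complex" where
  "partial_y F z = vector_derivative (\<lambda>t::real. F (z + of_real t * \<i>)) (at 0)"

text \<open>Real \<open>C\<^sup>k\<close> regularity on an open set: all iterated partial derivatives, in any order of
  differentiation, of order at most \<open>k\<close> exist and are continuous. The existence clauses are needed
  because \<^const>\<open>vector_derivative\<close> is total.\<close>

primrec Ck_on :: "nat \<Rightarrow> (complex \<Rightarrow> complex) \<Rightarrow> complex set \<Rightarrow> bool" where
  "Ck_on 0 F S \<longleftrightarrow> continuous_on S F"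
| "Ck_on (Suc k) F S \<longleftrightarrow> continuous_on S F \<and>
     (\<forall>z\<in>S. (\<lambda>t::real. F (z + of_real t)) differentiable (at 0) \<and>
             (\<lambda>t::real. F (z + of_real t * \<i>)) differentiable (at 0)) \<and>
     Ck_on k (partial_x F) S \<and> Ck_on k (partial_y F) S"

definition laplacian :: "(complex \<Rightarrow> complex) \<Rightarrow> complex \<Rightarrow> complex" where
  "laplacian F z = partial_x (partial_x F) z + partial_y (partial_y F) z"

text \<open>The inward unit normal of the unit circle at \<open>\<zeta>\<close> is \<open>- \<zeta>\<close>; since the function is only
  given on the closed disc, the derivative at the boundary point is one-sided.\<close>

definition has_inward_normal_derivative ::
    "(complex \<Rightarrow> complex) \<Rightarrow> complex \<Rightarrow> complex \<Rightarrow> bool" where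
  "has_inward_normal_derivative F d \<zeta> \<longleftrightarrow>
     ((\<lambda>t::real. F (\<zeta> + of_real t * (- \<zeta>))) has_vector_derivative d) (at 0 within {0..})"

definition circle_sup_norm :: "(complex \<Rightarrow> complex) \<Rightarrow> real" where
  "circle_sup_norm u = (SUP \<zeta>\<in>sphere 0 1. norm (u \<zeta>))"

definition biharmonic_solution ::
    "(complex \<Rightarrow> complex) \<Rightarrow> (complex \<Rightarrow> complex) \<Rightarrow> (complex \<Rightarrow> complex) \<Rightarrow>
     (complex \<Rightarrow> complex) \<Rightarrow> bool" where
  "biharmonic_solution g f h \<Phi> \<longleftrightarrow>
     Ck_on 4 \<Phi> (ball 0 1) \<and> continuous_on (cball 0 1) \<Phi> \<and>
     (\<forall>z\<in>ball 0 1. laplacian (laplacian \<Phi>) z = g z) \<and>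
     (\<forall>\<zeta>\<in>sphere 0 1. \<Phi> \<zeta> = f \<zeta>) \<and>
     (\<forall>\<zeta>\<in>sphere 0 1. has_inward_normal_derivative \<Phi> (h \<zeta>) \<zeta>)"

definition admissible ::
    "complex \<Rightarrow> (complex \<Rightarrow> complex) \<Rightarrow> (complex \<Rightarrow> complex) \<Rightarrow> (complex \<Rightarrow> complex) \<Rightarrow>
     (complex \<Rightarrow> complex) \<Rightarrow> bool" where
  "admissible \<eta> g f h \<Phi> \<longleftrightarrow>
     continuous_on (cball 0 1) g \<and> continuous_on (sphere 0 1) f \<and> continuous_on (sphere 0 1) h \<and>
     circle_sup_norm f \<le> 1 \<and> circle_sup_norm (\<lambda>\<zeta>. f \<zeta> + h \<zeta>) \<le> 1 \<and>
     biharmonic_solution g f h \<Phi> \<and>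
     ((\<lambda>r::real. norm (\<Phi> (of_real r * \<eta>))) \<longlongrightarrow> 1) (at_left 1)"

definition lower_radial_quotient :: "(complex \<Rightarrow> complex) \<Rightarrow> complex \<Rightarrow> ereal" where
  "lower_radial_quotient \<Phi> \<eta> =
     Liminf (at_left 1) (\<lambda>r::real. ereal (norm (\<Phi> \<eta> - \<Phi> (of_real r * \<eta>)) / (1 - r)))"

end

theory Submission
  imports Defs
begin

text \<open>
  With \<open>t = 1 - r\<close>, the radial difference quotient of \<open>\<Phi>\<close> at \<open>\<eta>\<close> is the modulus of the quotient
  that defines the inward normal derivative. Hence the lower limit is a limit, with value
  \<open>\<bar>h(\<eta>)\<bar>\<close> (\<open>lower_radial_quotient_eq_norm\<close>). Continuity of \<open>\<Phi>\<close> up to the boundary turns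
  \<open>\<bar>\<Phi>(r\<eta>)\<bar> \<rightarrow> 1\<close> into \<open>\<bar>f(\<eta>)\<bar> = 1\<close> (\<open>admissible_norm_boundary\<close>), and the triangle inequality gives
  \<open>\<bar>h(\<eta>)\<bar> \<ge> \<bar>f(\<eta>)\<bar> - \<bar>f(\<eta>) + h(\<eta>)\<bar> \<ge> 1 - \<parallel>f + h\<parallel>\<close>.

  For sharpness a single function serves all boundary points: \<open>(1 + \<bar>z\<bar>\<^sup>2) / 2\<close> has constant
  Laplacian, hence is biharmonic, and on the whole circle it has value \<open>1\<close> and inward normal
  derivative \<open>- 1\<close>. So \<open>f + h = 0\<close>, while the limit is \<open>\<bar>h(\<eta>)\<bar> = 1\<close>.
\<close>

text \<open>Compactness of the circle bounds \<open>\<bar>u\<bar>\<close>; for an unbounded function the real supremum in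
  \<^const>\<open>circle_sup_norm\<close> would carry no information.\<close>

lemma norm_le_circle_sup_norm:
  assumes "continuous_on (sphere 0 1) u" and "\<zeta> \<in> sphere 0 1"
  shows "norm (u \<zeta>) \<le> circle_sup_norm u"
proof -
  have "compact ((\<lambda>z. norm (u z)) ` sphere 0 1)"
    by (intro compact_continuous_image continuous_intros assms) auto
  then have "bdd_above ((\<lambda>z. norm (u z)) ` sphere 0 1)"
    by (intro bounded_imp_bdd_above compact_imp_bounded)
  then show ?thesis
    unfolding circle_sup_norm_def by (rule cSUP_upper[OF assms(2)])
qed

lemma circle_sup_norm_const: "circle_sup_norm (\<lambda>_. c) = norm c"
proof -
  have "(1::complex) \<in> sphere 0 1"
    by simp
  then have "sphere (0::complex) 1 \<noteq> {}"
    by blast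
  then show ?thesis
    by (simp add: circle_sup_norm_def)
qed

text \<open>The points \<open>\<eta> + t (- \<eta>)\<close> of the inward normal are the radial points \<open>r \<eta>\<close> with
  \<open>r = 1 - t\<close>, so \<open>r \<rightarrow> 1\<close> from the left corresponds to \<open>t \<rightarrow> 0\<close> from the right, and the quotient
  converges.\<close>

lemma lower_radial_quotient_eq_norm:
  assumes "has_inward_normal_derivative F d \<eta>"
  shows "lower_radial_quotient F \<eta> = ereal (norm d)"
proof -
  let ?G = "\<lambda>t::real. F (\<eta> + of_real t * (- \<eta>))"
  \<comment> \<open>For a derivative in a real variable, the Frechet remainder over \<open>\<bar>t\<bar>\<close> is, for \<open>t > 0\<close>, the
    difference quotient minus \<open>d\<close>.\<close>
  have "((\<lambda>t. (?G t - ?G 0 - (t - 0) *\<^sub>R d) /\<^sub>R norm (t - 0)) \<longlongrightarrow> 0) (at 0 within {0..})"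
    using assms unfolding has_inward_normal_derivative_def has_vector_derivative_def
      has_derivative_at_within by blast
  then have "((\<lambda>t. (?G t - ?G 0 - (t - 0) *\<^sub>R d) /\<^sub>R norm (t - 0)) \<longlongrightarrow> 0) (at_right 0)"
    by (rule tendsto_within_subset) auto
  moreover have "\<forall>\<^sub>F t in at_right 0.
      (?G t - ?G 0 - (t - 0) *\<^sub>R d) /\<^sub>R norm (t - 0) = (?G t - F \<eta>) /\<^sub>R t - d"
    by (rule eventually_at_rightI[of 0 1]) (auto simp: scaleR_diff_right)
  ultimately have "((\<lambda>t. (?G t - F \<eta>) /\<^sub>R t - d) \<longlongrightarrow> 0) (at_right 0)"
    by (rule Lim_transform_eventually)
  then have "((\<lambda>t. (?G t - F \<eta>) /\<^sub>R t) \<longlongrightarrow> d) (at_right 0)"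
    by (rule LIM_zero_cancel)
  moreover have "filterlim (\<lambda>r::real. 1 - r) (at_right 0) (at_left 1)"
    unfolding filterlim_at
    by (auto intro!: tendsto_eq_intros eventually_at_leftI[of 0])
  ultimately have "((\<lambda>r. (F (\<eta> + of_real (1 - r) * (- \<eta>)) - F \<eta>) /\<^sub>R (1 - r)) \<longlongrightarrow> d) (at_left 1)"
    by (rule filterlim_compose)
  then have "((\<lambda>r. norm ((F (\<eta> + of_real (1 - r) * (- \<eta>)) - F \<eta>) /\<^sub>R (1 - r))) \<longlongrightarrow> norm d) (at_left 1)"
    by (rule tendsto_norm)
  moreover have "\<forall>\<^sub>F r in at_left 1.
      norm ((F (\<eta> + of_real (1 - r) * (- \<eta>)) - F \<eta>) /\<^sub>R (1 - r)) =
      norm (F \<eta> - F (of_real r * \<eta>)) / (1 - r)"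
  proof (rule eventually_at_leftI[of 0])
    fix r :: real
    assume "r \<in> {0<..<1}"
    moreover have "\<eta> + of_real (1 - r) * (- \<eta>) = of_real r * \<eta>"
      by (simp add: algebra_simps)
    ultimately show "norm ((F (\<eta> + of_real (1 - r) * (- \<eta>)) - F \<eta>) /\<^sub>R (1 - r)) =
        norm (F \<eta> - F (of_real r * \<eta>)) / (1 - r)"
      by (simp only: norm_scaleR) (simp add: norm_minus_commute divide_inverse mult.commute)
  qed simp
  ultimately have "((\<lambda>r. norm (F \<eta> - F (of_real r * \<eta>)) / (1 - r)) \<longlongrightarrow> norm d) (at_left 1)"
    by (rule Lim_transform_eventually)
  then show ?thesis
    unfolding lower_radial_quotient_def by (intro lim_imp_Liminf) auto
qed

lemma admissible_norm_boundary:
  assumes "\<eta> \<in> sphere 0 1" and adm: "admissible \<eta> g f h \<Phi>"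
  shows "norm (f \<eta>) = 1"
proof -
  have cont: "continuous_on (cball 0 1) \<Phi>" and "\<Phi> \<eta> = f \<eta>"
    using assms by (auto simp: admissible_def biharmonic_solution_def)
  have "((\<lambda>r::real. of_real r * \<eta>) \<longlongrightarrow> of_real 1 * \<eta>) (at_left 1)"
    by (intro tendsto_intros)
  moreover have "\<forall>\<^sub>F r::real in at_left 1. of_real r * \<eta> \<in> cball 0 1"
    by (rule eventually_at_leftI[of 0]) (use assms in \<open>auto simp: norm_mult\<close>)
  ultimately have "((\<lambda>r::real. \<Phi> (of_real r * \<eta>)) \<longlongrightarrow> \<Phi> (of_real 1 * \<eta>)) (at_left 1)"
    using assms(1) by (intro continuous_on_tendsto_compose[OF cont]) auto
  then have "((\<lambda>r::real. norm (\<Phi> (of_real r * \<eta>))) \<longlongrightarrow> norm (f \<eta>)) (at_left 1)"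
    using \<open>\<Phi> \<eta> = f \<eta>\<close> by (intro tendsto_norm) simp
  then show ?thesis
    using adm unfolding admissible_def
    by (intro tendsto_unique[of "at_left (1::real)"]) auto
qed

lemma lower_radial_quotient_ge:
  assumes \<eta>: "\<eta> \<in> sphere 0 1" and adm: "admissible \<eta> g f h \<Phi>"
  shows "lower_radial_quotient \<Phi> \<eta> \<ge> ereal (1 - circle_sup_norm (\<lambda>\<zeta>. f \<zeta> + h \<zeta>))"
proof -
  have "norm (f \<eta> + h \<eta>) \<le> circle_sup_norm (\<lambda>\<zeta>. f \<zeta> + h \<zeta>)"
    using adm \<eta> unfolding admissible_def
    by (intro norm_le_circle_sup_norm continuous_on_add) auto
  moreover have "norm (f \<eta>) \<le> norm (f \<eta> + h \<eta>) + norm (h \<eta>)"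
    using norm_triangle_ineq4[of "f \<eta> + h \<eta>" "h \<eta>"] by simp
  moreover have "lower_radial_quotient \<Phi> \<eta> = ereal (norm (h \<eta>))"
    using adm \<eta> by (intro lower_radial_quotient_eq_norm)
      (auto simp: admissible_def biharmonic_solution_def)
  ultimately show ?thesis
    using admissible_norm_boundary[OF assms] by simp
qed

text \<open>The function \<open>(1 + \<bar>z\<bar>\<^sup>2) / 2\<close>, written as a polynomial in the coordinates so that its
  partial derivatives can be computed by the rules for real derivatives.\<close>

definition extremal :: "complex \<Rightarrow> complex" where
  "extremal z = of_real ((1 + (Re z)\<^sup>2 + (Im z)\<^sup>2) / 2)"

lemma extremal_radial: "extremal z = of_real ((1 + (norm z)\<^sup>2) / 2)"
  by (simp add: extremal_def cmod_power2 add.assoc)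

lemma partial_const [simp]: "partial_x (\<lambda>_. c) = (\<lambda>_. 0)" "partial_y (\<lambda>_. c) = (\<lambda>_. 0)"
  by (auto simp: partial_x_def partial_y_def)

lemma Ck_on_const: "Ck_on k (\<lambda>_. c) S"
  by (induction k arbitrary: c) auto

lemma partial_eqI:
  assumes "\<And>z. ((\<lambda>t::real. F (z + of_real t)) has_vector_derivative Fx z) (at 0)"
    and "\<And>z. ((\<lambda>t::real. F (z + of_real t * \<i>)) has_vector_derivative Fy z) (at 0)"
  shows "partial_x F = Fx" and "partial_y F = Fy"
  unfolding partial_x_def partial_y_def using assms by (auto intro!: ext vector_derivative_at)

text \<open>This replaces the partial derivatives in \<^const>\<open>Ck_on\<close>, which are values of a total
  operator, by explicit functions known to be derivatives; regularity of a polynomial can then be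
  checked one order at a time until the derivatives are constant.\<close>

lemma Ck_on_SucI:
  assumes "\<And>z. ((\<lambda>t::real. F (z + of_real t)) has_vector_derivative Fx z) (at 0)"
    and "\<And>z. ((\<lambda>t::real. F (z + of_real t * \<i>)) has_vector_derivative Fy z) (at 0)"
    and "continuous_on S F" and "Ck_on k Fx S" and "Ck_on k Fy S"
  shows "Ck_on (Suc k) F S"
  using assms(3-5) differentiableI_vector[OF assms(1)] differentiableI_vector[OF assms(2)]
  by (simp add: partial_eqI[of F Fx Fy, OF assms(1,2)])

text \<open>The constants are written as images under \<^const>\<open>of_real\<close>, so that the real derivative can be
  taken first and then embedded in the complex numbers.\<close>

lemma Re_line_derivatives:
  "((\<lambda>t::real. complex_of_real (Re (z + of_real t))) has_vector_derivative of_real 1) (at 0)"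
  "((\<lambda>t::real. complex_of_real (Re (z + of_real t * \<i>))) has_vector_derivative of_real 0) (at 0)"
  by (rule has_vector_derivative_of_real, (auto intro!: derivative_eq_intros)[1])+

lemma Im_line_derivatives:
  "((\<lambda>t::real. complex_of_real (Im (z + of_real t))) has_vector_derivative of_real 0) (at 0)"
  "((\<lambda>t::real. complex_of_real (Im (z + of_real t * \<i>))) has_vector_derivative of_real 1) (at 0)"
  by (rule has_vector_derivative_of_real, (auto intro!: derivative_eq_intros)[1])+

lemma extremal_line_derivatives:
  "((\<lambda>t::real. extremal (z + of_real t)) has_vector_derivative of_real (Re z)) (at 0)"
  "((\<lambda>t::real. extremal (z + of_real t * \<i>)) has_vector_derivative of_real (Im z)) (at 0)"
  unfolding extremal_def
  by (rule has_vector_derivative_of_real, (auto intro!: derivative_eq_intros)[1])+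

lemma laplacian_laplacian_extremal: "laplacian (laplacian extremal) = (\<lambda>_. 0)"
  by (simp add: laplacian_def[abs_def] partial_eqI[OF extremal_line_derivatives]
      partial_eqI[OF Re_line_derivatives] partial_eqI[OF Im_line_derivatives])

lemma continuous_on_extremal: "continuous_on S extremal"
  unfolding extremal_def[abs_def] by (intro continuous_intros) auto

lemma Ck_on_extremal: "Ck_on (Suc (Suc k)) extremal S"
proof (rule Ck_on_SucI[OF extremal_line_derivatives continuous_on_extremal])
  show "Ck_on (Suc k) (\<lambda>z. of_real (Re z)) S"
    by (rule Ck_on_SucI[OF Re_line_derivatives _ Ck_on_const Ck_on_const])
       (intro continuous_intros)
  show "Ck_on (Suc k) (\<lambda>z. of_real (Im z)) S"
    by (rule Ck_on_SucI[OF Im_line_derivatives _ Ck_on_const Ck_on_const])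
       (intro continuous_intros)
qed

lemma extremal_inward_normal_derivative:
  assumes "\<zeta> \<in> sphere 0 1"
  shows "has_inward_normal_derivative extremal (- 1) \<zeta>"
proof -
  have "extremal (\<zeta> + of_real t * (- \<zeta>)) = of_real ((1 + (1 - t)\<^sup>2) / 2)" for t :: real
  proof -
    have "norm (\<zeta> + of_real t * (- \<zeta>)) = norm (of_real (1 - t) * \<zeta>)"
      by (simp add: algebra_simps)
    also have "\<dots> = \<bar>1 - t\<bar>"
      using assms by (simp only: norm_mult norm_of_real) simp
    finally show ?thesis
      by (simp only: extremal_radial power2_abs)
  qed
  moreover have "((\<lambda>t::real. complex_of_real ((1 + (1 - t)\<^sup>2) / 2))
      has_vector_derivative of_real (- 1)) (at 0 within {0..})"
    by (rule has_vector_derivative_of_real) (auto intro!: derivative_eq_intros)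
  ultimately show ?thesis
    by (simp only: has_inward_normal_derivative_def of_real_minus of_real_1)
qed

lemma admissible_extremal:
  assumes "\<eta> \<in> sphere 0 1"
  shows "admissible \<eta> (\<lambda>_. 0) (\<lambda>_. 1) (\<lambda>_. - 1) extremal"
proof -
  have "((\<lambda>r::real. norm (extremal (of_real r * \<eta>))) \<longlongrightarrow> norm (extremal (of_real 1 * \<eta>)))
      (at_left 1)"
    unfolding extremal_def by (intro tendsto_intros) auto
  then have "((\<lambda>r::real. norm (extremal (of_real r * \<eta>))) \<longlongrightarrow> 1) (at_left 1)"
    using assms by (simp add: extremal_radial)
  moreover have "biharmonic_solution (\<lambda>_. 0) (\<lambda>_. 1) (\<lambda>_. - 1) extremal"
  proof -
    have "extremal \<zeta> = 1" if "\<zeta> \<in> sphere 0 1" for \<zeta>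
      using that by (simp add: extremal_radial)
    moreover have "Ck_on 4 extremal (ball 0 1)"
      using Ck_on_extremal[of 2 "ball 0 1"] by (simp only: add_2_eq_Suc[symmetric]) simp
    ultimately show ?thesis
      unfolding biharmonic_solution_def laplacian_laplacian_extremal
      using extremal_inward_normal_derivative continuous_on_extremal by blast
  qed
  ultimately show ?thesis
    by (simp add: admissible_def circle_sup_norm_const)
qed

theorem theorem6:
  fixes \<eta> :: complex
  assumes "\<eta> \<in> sphere 0 1"
  shows "(\<forall>g f h \<Phi>. admissible \<eta> g f h \<Phi> \<longrightarrow>
            lower_radial_quotient \<Phi> \<eta> \<ge> ereal (1 - circle_sup_norm (\<lambda>\<zeta>. f \<zeta> + h \<zeta>)))
       \<and> (\<forall>g f h \<Phi>. admissible \<eta> g f h \<Phi> \<and> circle_sup_norm (\<lambda>\<zeta>. f \<zeta> + h \<zeta>) = 0 \<longrightarrow>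
            lower_radial_quotient \<Phi> \<eta> \<ge> 1)
       \<and> (\<forall>C::real. C > 1 \<longrightarrow>
            \<not> (\<forall>g f h \<Phi>. admissible \<eta> g f h \<Phi> \<and> circle_sup_norm (\<lambda>\<zeta>. f \<zeta> + h \<zeta>) = 0 \<longrightarrow>
                  lower_radial_quotient \<Phi> \<eta> \<ge> ereal C))"
proof (intro conjI allI impI)
  fix g f h \<Phi>
  assume "admissible \<eta> g f h \<Phi>"
  then show "lower_radial_quotient \<Phi> \<eta> \<ge> ereal (1 - circle_sup_norm (\<lambda>\<zeta>. f \<zeta> + h \<zeta>))"
    by (rule lower_radial_quotient_ge[OF assms])
next
  fix g f h \<Phi>
  assume "admissible \<eta> g f h \<Phi> \<and> circle_sup_norm (\<lambda>\<zeta>. f \<zeta> + h \<zeta>) = 0"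
  then show "lower_radial_quotient \<Phi> \<eta> \<ge> 1"
    using lower_radial_quotient_ge[OF assms, of g f h \<Phi>] by (simp add: one_ereal_def)
next
  fix C :: real
  assume "C > 1"
  have "circle_sup_norm (\<lambda>\<zeta>. 1 + - 1) = 0"
    by (simp add: circle_sup_norm_const)
  with admissible_extremal[OF assms]
  have competitor: "admissible \<eta> (\<lambda>_. 0) (\<lambda>_. 1) (\<lambda>_. - 1) extremal \<and>
      circle_sup_norm (\<lambda>\<zeta>. (\<lambda>_. 1) \<zeta> + (\<lambda>_. - 1) \<zeta>) = 0"
    by simp
  have "lower_radial_quotient extremal \<eta> = ereal 1"
    using lower_radial_quotient_eq_norm[OF extremal_inward_normal_derivative[OF assms]] by simp
  then have too_small: "\<not> lower_radial_quotient extremal \<eta> \<ge> ereal C"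
    using \<open>C > 1\<close> by simp
  show "\<not> (\<forall>g f h \<Phi>. admissible \<eta> g f h \<Phi> \<and>
      circle_sup_norm (\<lambda>\<zeta>. f \<zeta> + h \<zeta>) = 0 \<longrightarrow> lower_radial_quotient \<Phi> \<eta> \<ge> ereal C)"
  proof
    assume all: "\<forall>g f h \<Phi>. admissible \<eta> g f h \<Phi> \<and>
      circle_sup_norm (\<lambda>\<zeta>. f \<zeta> + h \<zeta>) = 0 \<longrightarrow> lower_radial_quotient \<Phi> \<eta> \<ge> ereal C"
    from all[rule_format, OF competitor] too_small show False
      by contradiction
  qed
qed

end
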